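(* Let $\theta_1,\theta_2,\lambda_1,\lambda_2>0$ and $\beta\ge1$ with $\lambda_1\le\lambda_2$. Let $W\sim PE(\theta_1,\lambda_1)$, $X\sim GPE(\theta_2,\lambda_2,\beta)$, let $h:(0,\infty)\to\mathbb R$ be bounded (and measurable), and let $\tilde h(x)=h(x)-\mathbb E h(W)$. Then $$|\mathbb E h(X)-\mathbb E h(W)|\le\|\tilde h\|\left\{\frac{\lambda_2}{\lambda_1}|\beta-1|+\left|\frac{\lambda_2\theta_2}{\lambda_1\theta_1}\beta-1\right|+\left(\frac{\lambda_2}{\lambda_1}-1\right)\left(\lambda_1\mathbb E X+2\right)\right\}.$$
   Context: $PE(\theta,\lambda)$ (Poisson-exponential distribution, $\theta,\lambda>0$) has pdf $\frac{\theta\lambda e^{-\lambda w-\theta e^{-\lambda w}}}{1-e^{-\theta}}$, $w>0$. $GPE(\theta,\lambda,\beta)$ (generalised Poisson-exponential distribution, $\theta,\lambda,\beta>0$) has pdf $\frac{\beta\theta\lambda e^{-\lambda x-\theta\beta e^{-\lambda x}}}{(1-e^{-\theta})^\beta}\left(1-e^{-\theta+\theta e^{-\lambda x}}\right)^{\beta-1}$, $x>0$. $\|\cdot\|$ is the supremum norm. *)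

theory Defs
  imports "HOL-Probability.Probability"
begin

text \<open>
  Both distributions live on the open half-line, so they are taken as densities with respect to
  \<open>pos_lborel\<close>: a random variable with one of these laws is a measurable map into
  \<open>{0<..}\<close>, and its expectation under a function defined only on \<open>{0<..}\<close> does not depend
  on values of that function elsewhere.
\<close>

definition pos_lborel :: "real measure" where
  "pos_lborel = restrict_space lborel {0<..}"

definition pe_density :: "real \<Rightarrow> real \<Rightarrow> real \<Rightarrow> real" where
  "pe_density \<theta> lam w =
     \<theta> * lam * exp (- lam * w - \<theta> * exp (- lam * w)) / (1 - exp (- \<theta>))"

definition gpe_density :: "real \<Rightarrow> real \<Rightarrow> real \<Rightarrow> real \<Rightarrow> real" where
  "gpe_density \<theta> lam \<beta> x =
     \<beta> * \<theta> * lam * exp (- lam * x - \<theta> * \<beta> * exp (- lam * x)) / (1 - exp (- \<theta>)) powr \<beta>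
       * (1 - exp (- \<theta> + \<theta> * exp (- lam * x))) powr (\<beta> - 1)"

text \<open>The supremum norm of a function on \<open>{0<..}\<close>; meaningful only for bounded functions.\<close>

definition pos_sup_norm :: "(real \<Rightarrow> real) \<Rightarrow> real" where
  "pos_sup_norm f = (SUP x\<in>{0<..}. \<bar>f x\<bar>)"

end

theory Submission
  imports Defs
begin

text \<open>
  The proof is Stein's method by comparison of scores. Let \<open>p\<^sub>1\<close>, \<open>p\<^sub>2\<close> be the densities of \<open>W\<close>, \<open>X\<close>,
  let \<open>k = h - E h(W)\<close>, \<open>S = \<parallel>k\<parallel>\<close> and \<open>G(t) = \<integral>\<^sub>0\<^sup>t k p\<^sub>1\<close>. Integration by parts of
  \<open>E k(X) = \<integral> k p\<^sub>1 (p\<^sub>2 / p\<^sub>1)\<close> gives \<open>E k(X) = - E [D(X) f(X)]\<close>, where \<open>f = G / p\<^sub>1\<close> solves the Stein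
  equation of \<open>W\<close> and \<open>D = (ln p\<^sub>2)' - (ln p\<^sub>1)'\<close>. Since \<open>k\<close> is centred, \<open>\<bar>f\<bar>\<close> is at most \<open>S F / p\<^sub>1\<close> and
  \<open>S (1 - F) / p\<^sub>1\<close>, \<open>F\<close> being the distribution function of \<open>W\<close>; this yields
  \<open>\<lambda>\<^sub>1 \<theta>\<^sub>1 e\<^bsup>-\<lambda>\<^sub>1 x\<^esup> \<bar>f(x)\<bar> \<le> S min 1 (\<theta>\<^sub>1 (1 - e\<^bsup>-\<lambda>\<^sub>1 x\<^esup>))\<close> and \<open>\<lambda>\<^sub>1 \<bar>f\<bar> \<le> 2 S\<close>. With these,
  \<open>\<bar>D f\<bar>\<close> is bounded pointwise by the claimed expression with \<open>x\<close> in place of \<open>E X\<close>.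
\<close>

section \<open>Integration by parts on the positive half-line\<close>

text \<open>Fubini for \<open>g x * q' t\<close> on the region where \<open>x \<le> t\<close> and
  \<open>a \<le> t \<le> b\<close>: integrating out \<open>x\<close> first produces
  \<open>G\<close>, integrating out \<open>t\<close> first produces increments of \<open>q\<close>.
  This route never differentiates \<open>G\<close>, which matters because \<open>g\<close> is merely
  integrable.\<close>

lemma set_integral_deriv_mult_tail:
  fixes g q q' :: "real \<Rightarrow> real"
  assumes "a \<le> b" and g: "integrable lborel g"
    and q: "\<And>x. x \<in> {a..b} \<Longrightarrow> (q has_real_derivative q' x) (at x)"
    and cont: "continuous_on {a..b} q'"
  defines "G \<equiv> \<lambda>t. LINT x:{..t}|lborel. g x"
  shows "set_integrable lborel {a..b} (\<lambda>t. q' t * G t)"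
    and "(LINT t:{a..b}|lborel. q' t * G t)
      = q b * G b - q a * G a - (LINT x:{a..b}|lborel. g x * q x)"
proof -
  define r where "r = (\<lambda>t. indicator {a..b} t * q' t)"
  have r: "integrable lborel r"
    using borel_integrable_atLeastAtMost'[OF cont] unfolding r_def set_integrable_def by simp
  have [measurable]: "g \<in> borel_measurable borel" "r \<in> borel_measurable borel"
    using g r by auto
  have prod: "integrable (lborel \<Otimes>\<^sub>M lborel) (\<lambda>(x, t). g x * r t)"
    by (rule lborel_pair.Fubini_integrable) (auto simp: abs_mult intro!: g r)
  have int: "integrable (lborel \<Otimes>\<^sub>M lborel) (\<lambda>(x, t). g x * (r t * indicator {x..} t))"
    by (rule Bochner_Integration.integrable_bound[OF prod])
      (auto simp: abs_mult indicator_def mult_left_le split: prod.split)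
  have inner: "(\<integral>x. g x * (r t * indicator {x..} t) \<partial>lborel) = indicator {a..b} t *\<^sub>R (q' t * G t)" for t
  proof -
    have "(\<integral>x. g x * (r t * indicator {x..} t) \<partial>lborel) = (\<integral>x. r t * (indicator {..t} x *\<^sub>R g x) \<partial>lborel)"
      by (rule Bochner_Integration.integral_cong) (auto simp: indicator_def)
    then show ?thesis by (simp add: r_def G_def set_lebesgue_integral_def)
  qed
  show "set_integrable lborel {a..b} (\<lambda>t. q' t * G t)"
    using lborel_pair.integrable_snd[OF int] unfolding inner set_integrable_def .
  \<comment> \<open>For fixed \<open>x\<close>, the variable \<open>t\<close> runs from
    \<open>max a x\<close> to \<open>b\<close>: points below \<open>a\<close> see the whole
    increment of \<open>q\<close>, points above \<open>b\<close> see nothing.\<close>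
  have FTC: "(\<integral>t. r t * indicator {x..} t \<partial>lborel) = indicator {..b} x * (q b - q (max a x))" for x
  proof (cases "x \<le> b")
    case True
    have "(\<integral>t. r t * indicator {x..} t \<partial>lborel) = (\<integral>t. indicator {max a x..b} t *\<^sub>R q' t \<partial>lborel)"
      by (rule Bochner_Integration.integral_cong) (auto simp: r_def indicator_def)
    also have "\<dots> = q b - q (max a x)"
      using True \<open>a \<le> b\<close>
      by (intro integral_FTC_Icc)
        (auto intro!: has_vector_derivative_at_within continuous_on_subset[OF cont]
           q[unfolded has_real_derivative_iff_has_vector_derivative])
    finally show ?thesis using True by simp
  next
    case False
    then have "(\<lambda>t. r t * indicator {x..} t) = (\<lambda>_. 0)" by (auto simp: r_def indicator_def)
    with False show ?thesis by simp
  qed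
  have cq: "continuous_on {a..b} q"
    using q by (meson DERIV_isCont continuous_at_imp_continuous_on)
  have I1: "set_integrable lborel {..<a} g" "set_integrable lborel {..b} g" "set_integrable lborel {..a} g"
    using g unfolding set_integrable_def by (auto intro: integrable_real_mult_indicator simp: mult.commute)
  \<comment> \<open>By compactness \<open>q\<close> is bounded on the interval, so a multiple of
    \<open>g\<close> dominates the product.\<close>
  have I2: "set_integrable lborel {a..b} (\<lambda>x. g x * q x)"
  proof -
    obtain B where B: "\<And>x. x \<in> {a..b} \<Longrightarrow> \<bar>q x\<bar> \<le> B"
      using compact_imp_bounded[OF compact_continuous_image[OF cq compact_Icc]]
      unfolding bounded_iff by (metis imageI real_norm_def)
    have "set_borel_measurable borel {a..b} q"
      using cq borel_measurable_continuous_on_indicator[of "{a..b}" q]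
      unfolding set_borel_measurable_def by simp
    then have m: "(\<lambda>x. indicator {a..b} x * q x) \<in> borel_measurable borel"
      unfolding set_borel_measurable_def by simp
    have "(\<lambda>x. g x * (indicator {a..b} x * q x)) \<in> borel_measurable borel"
      using m by measurable
    then have m2: "(\<lambda>x. indicator {a..b} x *\<^sub>R (g x * q x)) \<in> borel_measurable borel"
      by (simp add: ac_simps)
    have "integrable lborel (\<lambda>x. B * g x)" using g by simp
    then show ?thesis unfolding set_integrable_def
    proof (rule Bochner_Integration.integrable_bound)
      have "\<bar>g x\<bar> * \<bar>q x\<bar> \<le> \<bar>B\<bar> * \<bar>g x\<bar>" if "x \<in> {a..b}" for x
        using mult_right_mono[OF order_trans[OF B[OF that] abs_ge_self], of "\<bar>g x\<bar>"]
        by (simp add: mult.commute)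
      then show "AE x in lborel. norm (indicator {a..b} x *\<^sub>R (g x * q x)) \<le> norm (B * g x)"
        by (intro AE_I2) (auto simp: indicator_def abs_mult)
    qed (use m2 in simp)
  qed
  have "(LINT t:{a..b}|lborel. q' t * G t)
      = (\<integral>x. (\<integral>t. g x * (r t * indicator {x..} t) \<partial>lborel) \<partial>lborel)"
    using lborel_pair.Fubini_integral[OF int] unfolding inner set_lebesgue_integral_def .
  also have "\<dots> = (\<integral>x. g x * (indicator {..b} x * (q b - q (max a x))) \<partial>lborel)"
    by (simp add: FTC)
  \<comment> \<open>\<open>q b\<close> collects all \<open>x \<le> b\<close>, while
    \<open>q (max a x)\<close> is the constant \<open>q a\<close> for \<open>x < a\<close> and
    \<open>q x\<close> on the interval.\<close>
  also have "\<dots> = (\<integral>x. q b * (indicator {..b} x *\<^sub>R g x) - q a * (indicator {..<a} x *\<^sub>R g x)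
      - indicator {a..b} x *\<^sub>R (g x * q x) \<partial>lborel)"
    using \<open>a \<le> b\<close>
    by (intro Bochner_Integration.integral_cong) (auto simp: indicator_def algebra_simps max_def)
  also have "\<dots> = q b * G b - q a * (LINT x:{..<a}|lborel. g x) - (LINT x:{a..b}|lborel. g x * q x)"
    using I1 I2 unfolding G_def set_lebesgue_integral_def set_integrable_def
    by simp
  also have "(LINT x:{..<a}|lborel. g x) = G a"
    unfolding G_def by (rule set_integral_cong_set)
      (use I1 AE_lborel_singleton[of a] in \<open>auto simp: set_integrable_def set_borel_measurable_def elim!: eventually_mono\<close>)
  finally show "(LINT t:{a..b}|lborel. q' t * G t)
      = q b * G b - q a * G a - (LINT x:{a..b}|lborel. g x * q x)" .
qed

text \<open>Integration by parts on compact intervals exhausting the half-line. The boundary terms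
  die by the two limits, and \<open>K\<close> dominates the remaining integral uniformly in the
  interval.\<close>

lemma integral_mult_le_by_parts:
  fixes g q q' K :: "real \<Rightarrow> real"
  assumes g: "integrable lborel g"
    and q: "\<And>x. 0 < x \<Longrightarrow> (q has_real_derivative q' x) (at x)"
    and cont: "continuous_on {0<..} q'"
    and gq: "set_integrable lborel {0<..} (\<lambda>x. g x * q x)"
    and K: "set_integrable lborel {0<..} K"
  defines "G \<equiv> \<lambda>t. LINT x:{..t}|lborel. g x"
  assumes bound: "\<And>x. 0 < x \<Longrightarrow> \<bar>q' x * G x\<bar> \<le> K x"
    and lim_0: "((\<lambda>x. q x * G x) \<longlongrightarrow> 0) (at_right 0)"
    and lim_top: "((\<lambda>x. q x * G x) \<longlongrightarrow> 0) at_top"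
  shows "\<bar>LINT x:{0<..}|lborel. g x * q x\<bar> \<le> (LINT x:{0<..}|lborel. K x)"
proof -
  \<comment> \<open>With \<open>Suc\<close> even the interval of index 0 is legitimate: it is the
    single point 1.\<close>
  define a b where "a = (\<lambda>n. 1 / real (Suc n))" and "b = (\<lambda>n. real (Suc n))"
  have ab: "0 < a n" "a n \<le> b n" for n
    unfolding a_def b_def by (auto simp: field_simps)
  have lims: "filterlim a (at_right 0) sequentially" "filterlim b at_top sequentially"
    unfolding a_def b_def by real_asymp+
  \<comment> \<open>The hypothesis \<open>bound\<close> forces \<open>K\<close> to be nonnegative on
    the half-line, so its integral over the interval may be enlarged to the one over
    \<open>{0<..}\<close>.\<close>
  have finite: "\<bar>LINT x:{a n..b n}|lborel. g x * q x\<bar>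
      \<le> \<bar>q (b n) * G (b n)\<bar> + \<bar>q (a n) * G (a n)\<bar> + (LINT x:{0<..}|lborel. K x)" for n
  proof -
    have parts: "set_integrable lborel {a n..b n} (\<lambda>t. q' t * G t)"
      "(LINT t:{a n..b n}|lborel. q' t * G t)
      = q (b n) * G (b n) - q (a n) * G (a n) - (LINT x:{a n..b n}|lborel. g x * q x)"
      unfolding G_def using ab[of n]
      by (auto intro!: set_integral_deriv_mult_tail g q intro: continuous_on_subset[OF cont])
    have "\<bar>LINT t:{a n..b n}|lborel. q' t * G t\<bar> \<le> (LINT x:{0<..}|lborel. K x)"
      unfolding set_lebesgue_integral_def
    proof (rule integral_abs_bound_integral)
      show "\<bar>indicator {a n..b n} x *\<^sub>R (q' x * G x)\<bar> \<le> indicator {0<..} x *\<^sub>R K x" for x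
        using bound[of x] ab[of n] by (auto simp: indicator_def)
    qed (use parts K in \<open>auto simp: set_integrable_def\<close>)
    then show ?thesis using parts(2) by linarith
  qed
  have lhs: "(\<lambda>n. LINT x:{a n..b n}|lborel. g x * q x) \<longlonglongrightarrow> (LINT x:{0<..}|lborel. g x * q x)"
    unfolding set_lebesgue_integral_def
  proof (rule integral_dominated_convergence)
    show "integrable lborel (\<lambda>x. norm (indicator {0<..} x *\<^sub>R (g x * q x)))"
      using gq unfolding set_integrable_def by (rule integrable_norm)
    show "(\<lambda>x. indicator {0<..} x *\<^sub>R (g x * q x)) \<in> borel_measurable lborel"
      using gq unfolding set_integrable_def by auto
    show "(\<lambda>x. indicator {a n..b n} x *\<^sub>R (g x * q x)) \<in> borel_measurable lborel" for n
    proof -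
      have "set_integrable lborel {a n..b n} (\<lambda>x. g x * q x)"
        by (rule set_integrable_subset[OF gq]) (use ab[of n] in auto)
      then show ?thesis unfolding set_integrable_def by auto
    qed
    show "AE x in lborel. norm (indicator {a n..b n} x *\<^sub>R (g x * q x))
        \<le> norm (indicator {0<..} x *\<^sub>R (g x * q x))" for n
      using ab[of n] by (intro AE_I2) (auto simp: indicator_def)
    show "AE x in lborel. (\<lambda>n. indicator {a n..b n} x *\<^sub>R (g x * q x))
        \<longlonglongrightarrow> indicator {0<..} x *\<^sub>R (g x * q x)"
    proof (rule AE_I2)
      fix x :: real
      \<comment> \<open>A positive \<open>x\<close> is eventually caught by the growing intervals;
        any other \<open>x\<close> lies in none of them. Hence the indicators are eventually equal,
        not just convergent.\<close>
      have ev: "\<forall>\<^sub>F n in sequentially. indicator {a n..b n} x = (indicator {0<..} x :: real)"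
      proof (cases "x > 0")
        case True
        have "\<forall>\<^sub>F n in sequentially. a n < x"
          using lims(1) True order_tendstoD(2)[of a 0] by (simp add: filterlim_at)
        moreover have "\<forall>\<^sub>F n in sequentially. x \<le> b n"
          using lims(2) by (simp add: filterlim_at_top)
        ultimately show ?thesis by eventually_elim (use True in auto)
      next
        case False
        then show ?thesis using ab by (intro always_eventually) (auto simp: indicator_def intro: order.strict_trans2)
      qed
      show "(\<lambda>n. indicator {a n..b n} x *\<^sub>R (g x * q x)) \<longlonglongrightarrow> indicator {0<..} x *\<^sub>R (g x * q x)"
        by (rule tendsto_eventually) (use ev in \<open>auto elim: eventually_mono\<close>)
    qed
  qed
  have rhs: "(\<lambda>n. \<bar>q (b n) * G (b n)\<bar> + \<bar>q (a n) * G (a n)\<bar> + (LINT x:{0<..}|lborel. K x))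
      \<longlonglongrightarrow> \<bar>0\<bar> + \<bar>0\<bar> + (LINT x:{0<..}|lborel. K x)"
    by (intro tendsto_intros filterlim_compose[OF lim_0 lims(1)] filterlim_compose[OF lim_top lims(2)])
  show ?thesis
    using LIMSEQ_le[OF tendsto_rabs[OF lhs] rhs] finite by auto
qed

section \<open>The Poisson-exponential law and its Stein solution\<close>

text \<open>The formula is not cut off to 0 on the negative axis. It is the distribution function
  only for \<open>x \<ge> 0\<close>, but it stays differentiable in the two-sided sense at 0, as the
  fundamental theorem on \<open>{0..x}\<close> requires.\<close>

definition pe_cdf :: "real \<Rightarrow> real \<Rightarrow> real \<Rightarrow> real" where
  "pe_cdf \<theta> lam x = (exp (- \<theta> * exp (- lam * x)) - exp (- \<theta>)) / (1 - exp (- \<theta>))"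

lemma pe_density_pos: "0 < \<theta> \<Longrightarrow> 0 < lam \<Longrightarrow> 0 < pe_density \<theta> lam x"
  by (simp add: pe_density_def)

lemma borel_measurable_pe_density [measurable]: "pe_density \<theta> lam \<in> borel_measurable borel"
  unfolding pe_density_def by measurable

lemma pe_density_eq:
  "pe_density \<theta> lam x = \<theta> * lam * exp (- lam * x) * exp (- \<theta> * exp (- lam * x)) / (1 - exp (- \<theta>))"
proof -
  have "exp (- lam * x - \<theta> * exp (- lam * x)) = exp (- lam * x) * exp (- \<theta> * exp (- lam * x))"
    unfolding exp_add[symmetric] by simp
  then show ?thesis by (simp add: pe_density_def)
qed

lemma DERIV_pe_cdf: "(pe_cdf \<theta> lam has_real_derivative pe_density \<theta> lam x) (at x)"
proof -
  have "((\<lambda>x. exp (- \<theta> * exp (- lam * x))) has_real_derivative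
      \<theta> * lam * exp (- lam * x) * exp (- \<theta> * exp (- lam * x))) (at x)"
    by (rule derivative_eq_intros refl)+ simp
  from DERIV_cdivide[OF DERIV_diff[OF this DERIV_const]] show ?thesis
    unfolding pe_cdf_def[abs_def] pe_density_eq by simp
qed

lemma pe_cdf_0: "pe_cdf \<theta> lam 0 = 0"
  by (simp add: pe_cdf_def)

lemma pe_cdf_le_1: "0 < \<theta> \<Longrightarrow> pe_cdf \<theta> lam x \<le> 1"
  by (simp add: pe_cdf_def field_simps)

lemma pe_cdf_tendsto_1:
  assumes "0 < \<theta>" "0 < lam"
  shows "(pe_cdf \<theta> lam \<longlongrightarrow> 1) at_top"
proof -
  have "((\<lambda>x. (exp (- \<theta> * exp (- lam * x)) - exp (- \<theta>)) / (1 - exp (- \<theta>))) \<longlongrightarrow>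
     (exp (- \<theta> * 0) - exp (- \<theta>)) / (1 - exp (- \<theta>))) at_top"
  proof (intro tendsto_intros)
    show "((\<lambda>x. exp (- lam * x)) \<longlongrightarrow> 0) at_top" using assms by real_asymp
  qed (use assms in auto)
  then show "(pe_cdf \<theta> lam \<longlongrightarrow> 1) at_top"
    using assms unfolding pe_cdf_def[abs_def] by simp
qed

lemma has_bochner_integral_pe_density_Icc:
  assumes "0 < \<theta>" "0 < lam" "0 \<le> x"
  shows "has_bochner_integral lborel (\<lambda>t. pe_density \<theta> lam t * indicator {0..x} t) (pe_cdf \<theta> lam x)"
  using has_bochner_integral_FTC_Icc_nonneg[of "pe_density \<theta> lam" 0 x "pe_cdf \<theta> lam"]
    DERIV_pe_cdf pe_density_pos assms by (simp add: less_imp_le pe_cdf_0)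

lemma has_bochner_integral_pe_density_Ici:
  assumes "0 < \<theta>" "0 < lam" "0 \<le> x"
  shows "has_bochner_integral lborel (\<lambda>t. pe_density \<theta> lam t * indicator {x..} t) (1 - pe_cdf \<theta> lam x)"
proof (rule has_bochner_integral_nn_integral)
  have "(\<integral>\<^sup>+ t. ennreal (pe_density \<theta> lam t) * indicator {x..} t \<partial>lborel) = ennreal (1 - pe_cdf \<theta> lam x)"
    using assms
    by (intro nn_integral_FTC_atLeast DERIV_pe_cdf pe_cdf_tendsto_1) (auto intro: less_imp_le pe_density_pos)
  then show "(\<integral>\<^sup>+ t. ennreal (pe_density \<theta> lam t * indicator {x..} t) \<partial>lborel) = ennreal (1 - pe_cdf \<theta> lam x)"
    by (simp add: nn_integral_set_ennreal)
qed (use assms in \<open>auto simp: pe_cdf_le_1 less_imp_le[OF pe_density_pos]\<close>)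

text \<open>The ratio of distribution function to density, cleared of denominators. Splitting
  \<open>exp (- \<theta>)\<close> as
  \<open>exp (- \<theta> * (1 - v)) * exp (- \<theta> * v)\<close> with
  \<open>v = exp (- lam * x)\<close> exposes in the numerator the factor that the density also
  carries.\<close>

lemma pe_cdf_eq_mult_density:
  "lam * \<theta> * exp (- lam * x) * pe_cdf \<theta> lam x
    = (1 - exp (- \<theta> * (1 - exp (- lam * x)))) * pe_density \<theta> lam x"
proof -
  have "exp (- \<theta> * (1 - exp (- lam * x))) * exp (- \<theta> * exp (- lam * x)) = exp (- \<theta>)"
    unfolding exp_add[symmetric] by (simp add: algebra_simps)
  then have "exp (- \<theta> * exp (- lam * x)) - exp (- \<theta>)
      = (1 - exp (- \<theta> * (1 - exp (- lam * x)))) * exp (- \<theta> * exp (- lam * x))"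
    by (simp add: left_diff_distrib)
  then show ?thesis unfolding pe_cdf_def pe_density_eq by simp
qed

text \<open>The companion ratio for the upper tail, again by pulling out
  \<open>exp (- \<theta> * v)\<close> with \<open>v = exp (- lam * x)\<close>.\<close>

lemma pe_tail_eq_mult_density:
  assumes "0 < \<theta>"
  shows "lam * \<theta> * exp (- lam * x) * (1 - pe_cdf \<theta> lam x)
    = (exp (\<theta> * exp (- lam * x)) - 1) * pe_density \<theta> lam x"
proof -
  have "exp (\<theta> * exp (- lam * x)) * exp (- \<theta> * exp (- lam * x)) = 1"
    unfolding exp_add[symmetric] by simp
  then have "1 - exp (- \<theta> * exp (- lam * x))
      = (exp (\<theta> * exp (- lam * x)) - 1) * exp (- \<theta> * exp (- lam * x))"
    by (simp add: left_diff_distrib)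
  moreover have "1 - pe_cdf \<theta> lam x = (1 - exp (- \<theta> * exp (- lam * x))) / (1 - exp (- \<theta>))"
    using assms unfolding pe_cdf_def by (subst diff_divide_eq_iff) auto
  ultimately show ?thesis unfolding pe_density_eq by simp
qed

text \<open>Source of the constant 2 in the final estimate. For \<open>a \<le> 1\<close> the
  quadratic bound on \<open>exp\<close> gives \<open>a + a\<^sup>2 \<le> 2 * a\<close>; for larger
  \<open>a\<close> the bound by 1 already suffices.\<close>

lemma min_exp_minus_one_le:
  fixes a :: real
  assumes "0 \<le> a" "y \<le> exp a - 1" "y \<le> 1"
  shows "y \<le> 2 * a"
proof (cases "a \<le> 1")
  case True
  then have "exp a \<le> 1 + a + a\<^sup>2" using assms exp_bound by auto
  moreover have "a\<^sup>2 \<le> a" using True assms by (simp add: power2_eq_square mult_left_le)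
  ultimately show ?thesis using assms by simp
qed (use assms in auto)

text \<open>\<open>R\<close> is the modulus of the Stein solution. Dominating \<open>g\<close> by
  \<open>S\<close> times the density bounds the partial integral by \<open>S\<close> times either
  tail of the law, and the two ratio identities turn this into bounds on \<open>R\<close>. The first
  keeps the lower tail, hence vanishes at 0; the second combines both tails.\<close>

lemma
  fixes g :: "real \<Rightarrow> real"
  assumes \<theta>: "0 < \<theta>" and lam: "0 < lam" and x: "0 \<le> x"
    and g: "integrable lborel g" "(\<integral>t. g t \<partial>lborel) = 0"
    and g_le: "\<And>t. \<bar>g t\<bar> \<le> S * (indicator {0<..} t * pe_density \<theta> lam t)"
  defines "R \<equiv> \<bar>LINT t:{..x}|lborel. g t\<bar> / pe_density \<theta> lam x"
  shows stein_pe_le_cdf: "lam * \<theta> * exp (- lam * x) * R \<le> S * (1 - exp (- \<theta> * (1 - exp (- lam * x))))"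
    and stein_pe_le: "lam * R \<le> 2 * S"
proof -
  let ?p = "pe_density \<theta> lam" and ?F = "pe_cdf \<theta> lam"
  define v where "v = exp (- lam * x)"
  have v: "0 < v" "v \<le> 1" using lam x by (auto simp: v_def)
  have p: "0 < ?p x" using \<theta> lam by (rule pe_density_pos)
  \<comment> \<open>Nonnegativity of \<open>S\<close> is read off from \<open>g_le\<close> at one
    point where the density is positive.\<close>
  have S: "0 \<le> S"
    using order_trans[OF abs_ge_zero g_le[of 1]] pe_density_pos[OF \<theta> lam, of 1]
    by (simp add: zero_le_mult_iff)
  have Sp: "0 \<le> S * ?p t" for t
    using S pe_density_pos[OF \<theta> lam, of t] by simp
  have set_int: "integrable lborel (\<lambda>t. indicator {..x} t *\<^sub>R g t)" "integrable lborel (\<lambda>t. indicator {x<..} t *\<^sub>R g t)"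
    using g(1) by (auto intro: integrable_real_mult_indicator simp: mult.commute)
  have lower: "\<bar>LINT t:{..x}|lborel. g t\<bar> \<le> S * ?F x"
  proof -
    note I = has_bochner_integral_pe_density_Icc[OF \<theta> lam x]
    have "\<bar>LINT t:{..x}|lborel. g t\<bar> \<le> (\<integral>t. S * (?p t * indicator {0..x} t) \<partial>lborel)"
      unfolding set_lebesgue_integral_def
    proof (rule integral_abs_bound_integral)
      show "\<bar>indicator {..x} t *\<^sub>R g t\<bar> \<le> S * (?p t * indicator {0..x} t)" for t
        using g_le[of t] Sp[of t] by (cases "0 < t") (auto simp: indicator_def)
    qed (use set_int I in \<open>auto simp: has_bochner_integral_iff\<close>)
    then show ?thesis using I by (simp add: has_bochner_integral_iff)
  qed
  \<comment> \<open>Since \<open>g\<close> integrates to 0, its integrals below and above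
    \<open>x\<close> have equal modulus.\<close>
  have upper: "\<bar>LINT t:{..x}|lborel. g t\<bar> \<le> S * (1 - ?F x)"
  proof -
    note I = has_bochner_integral_pe_density_Ici[OF \<theta> lam x]
    have "0 = (\<integral>t. indicator {..x} t *\<^sub>R g t + indicator {x<..} t *\<^sub>R g t \<partial>lborel)"
      unfolding g(2)[symmetric] by (rule Bochner_Integration.integral_cong) (auto simp: indicator_def)
    also have "\<dots> = (LINT t:{..x}|lborel. g t) + (LINT t:{x<..}|lborel. g t)"
      unfolding set_lebesgue_integral_def by (rule Bochner_Integration.integral_add[OF set_int])
    finally have "\<bar>LINT t:{..x}|lborel. g t\<bar> = \<bar>LINT t:{x<..}|lborel. g t\<bar>" by linarith
    also have "\<dots> \<le> (\<integral>t. S * (?p t * indicator {x..} t) \<partial>lborel)"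
      unfolding set_lebesgue_integral_def
    proof (rule integral_abs_bound_integral)
      show "\<bar>indicator {x<..} t *\<^sub>R g t\<bar> \<le> S * (?p t * indicator {x..} t)" for t
        using g_le[of t] Sp[of t] x by (cases "x < t") (auto simp: indicator_def)
    qed (use set_int I in \<open>auto simp: has_bochner_integral_iff\<close>)
    finally show ?thesis using I by (simp add: has_bochner_integral_iff)
  qed
  have pos: "0 \<le> lam * \<theta> * v" using lam \<theta> v by simp
  have *: "lam * \<theta> * v * \<bar>LINT t:{..x}|lborel. g t\<bar> \<le> S * (1 - exp (- \<theta> * (1 - v))) * ?p x"
    using mult_left_mono[OF lower pos] pe_cdf_eq_mult_density[of lam \<theta> x]
    by (simp add: v_def mult_ac)
  have **: "lam * \<theta> * v * \<bar>LINT t:{..x}|lborel. g t\<bar> \<le> S * (exp (\<theta> * v) - 1) * ?p x"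
    using mult_left_mono[OF upper pos] pe_tail_eq_mult_density[OF \<theta>, of lam x]
    by (simp add: v_def mult_ac)
  show 1: "lam * \<theta> * exp (- lam * x) * R \<le> S * (1 - exp (- \<theta> * (1 - exp (- lam * x))))"
    using * p unfolding R_def v_def by (simp add: divide_simps mult_ac)
  have 2: "lam * \<theta> * v * R \<le> S * (exp (\<theta> * v) - 1)"
    using ** p unfolding R_def by (simp add: divide_simps mult_ac)
  \<comment> \<open>The lower-tail factor is at most 1 and the upper-tail factor is
    \<open>exp a - 1\<close> with \<open>a = \<theta> * v\<close>, so their minimum is at most
    \<open>2 * a\<close>; the factor \<open>\<theta> * v\<close> then cancels.\<close>
  have "lam * \<theta> * v * R \<le> S * min (exp (\<theta> * v) - 1) (1 - exp (- \<theta> * (1 - v)))"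
    using 1 2 by (simp add: min_def v_def)
  also have "\<dots> \<le> S * (2 * (\<theta> * v))"
    by (intro mult_left_mono S min_exp_minus_one_le) (use \<theta> v in \<open>auto intro: min.coboundedI2\<close>)
  finally have "(\<theta> * v) * (lam * R) \<le> (\<theta> * v) * (2 * S)" by (simp add: mult_ac)
  then show "lam * R \<le> 2 * S" using \<theta> v by simp
qed

section \<open>Score, envelope and moments of the generalised law\<close>

text \<open>The logarithmic derivative of \<open>gpe_density\<close> on the positive axis. The last
  summand stems from the \<open>powr\<close> factor and vanishes for \<beta> = 1, which leaves the
  score of the Poisson-exponential law.\<close>

definition gpe_score :: "real \<Rightarrow> real \<Rightarrow> real \<Rightarrow> real \<Rightarrow> real" where
  "gpe_score \<theta> lam \<beta> x = lam * \<theta> * \<beta> * exp (- lam * x) - lam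
     + (\<beta> - 1) * lam * \<theta> * exp (- lam * x) / (exp (\<theta> * (1 - exp (- lam * x))) - 1)"

lemma gpe_density_nonneg: "0 < \<theta> \<Longrightarrow> 0 < lam \<Longrightarrow> 0 \<le> \<beta> \<Longrightarrow> 0 \<le> gpe_density \<theta> lam \<beta> x"
  by (simp add: gpe_density_def)

lemma borel_measurable_gpe_density [measurable]: "gpe_density \<theta> lam \<beta> \<in> borel_measurable borel"
  unfolding gpe_density_def by measurable

text \<open>For \<open>\<beta> \<ge> 1\<close> the \<open>powr\<close> factor has base and value at
  most 1, so only the exponential decay remains. This envelope serves both integrability and the
  boundary limits.\<close>

lemma gpe_density_le:
  assumes "0 < \<theta>" "0 < lam" "1 \<le> \<beta>" "0 < x"
  shows "gpe_density \<theta> lam \<beta> x \<le> \<beta> * \<theta> * lam / (1 - exp (- \<theta>)) powr \<beta> * exp (- lam * x)"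
proof -
  have "exp (- \<theta> + \<theta> * exp (- lam * x)) < 1"
    using assms by auto
  then have "(1 - exp (- \<theta> + \<theta> * exp (- lam * x))) powr (\<beta> - 1) \<le> 1"
    using assms by (intro powr_le1) auto
  moreover have "exp (- lam * x - \<theta> * \<beta> * exp (- lam * x)) \<le> exp (- lam * x)"
    using assms by simp
  ultimately have "\<beta> * \<theta> * lam / (1 - exp (- \<theta>)) powr \<beta> * (exp (- lam * x - \<theta> * \<beta> * exp (- lam * x))
      * (1 - exp (- \<theta> + \<theta> * exp (- lam * x))) powr (\<beta> - 1))
    \<le> \<beta> * \<theta> * lam / (1 - exp (- \<theta>)) powr \<beta> * (exp (- lam * x) * 1)"
    using assms by (intro mult_left_mono mult_mono) auto
  then show ?thesis by (simp add: gpe_density_def)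
qed

lemma DERIV_gpe_density:
  assumes "0 < \<theta>" "0 < lam" "0 < x"
  shows "(gpe_density \<theta> lam \<beta> has_real_derivative gpe_density \<theta> lam \<beta> x * gpe_score \<theta> lam \<beta> x) (at x)"
proof -
  let ?u = "exp (- lam * x)" let ?w = "1 - exp (- \<theta> + \<theta> * ?u)"
  have w: "0 < ?w" using assms by simp
  \<comment> \<open>Rewrites the denominator in \<open>gpe_score\<close> through the base
    \<open>?w\<close> of the \<open>powr\<close> factor, which is the form the chain rule
    delivers.\<close>
  have "exp (\<theta> * (1 - ?u)) * exp (- \<theta> + \<theta> * ?u) = 1"
    unfolding exp_add[symmetric] by (simp add: algebra_simps)
  then have "exp (\<theta> * (1 - ?u)) - 1 = ?w / exp (- \<theta> + \<theta> * ?u)"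
    by (subst eq_divide_eq) (simp add: left_diff_distrib)
  then have *: "?u / (exp (\<theta> * (1 - ?u)) - 1) = ?u * exp (- \<theta> + \<theta> * ?u) / ?w"
    by simp
  let ?w' = "lam * \<theta> * ?u * exp (- \<theta> + \<theta> * ?u)"
  have "((\<lambda>x. 1 - exp (- \<theta> + \<theta> * exp (- lam * x))) has_real_derivative ?w') (at x)"
    by (rule derivative_eq_intros refl)+ simp
  note chain = DERIV_chain2[OF has_real_derivative_powr[OF w, of "\<beta> - 1"] this]
  have "?w powr (\<beta> - 1 - 1) = ?w powr (\<beta> - 1) / ?w"
    using w powr_diff[of ?w "\<beta> - 1" 1] by simp
  then have dw: "((\<lambda>x. (1 - exp (- \<theta> + \<theta> * exp (- lam * x))) powr (\<beta> - 1)) has_real_derivative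
      ?w powr (\<beta> - 1) * ((\<beta> - 1) * ?w' / ?w)) (at x)"
    by (intro DERIV_cong[OF chain]) (simp only: times_divide_eq_right times_divide_eq_left mult_ac)
  have "((\<lambda>x. exp (- lam * x - \<theta> * \<beta> * exp (- lam * x))) has_real_derivative
      exp (- lam * x - \<theta> * \<beta> * ?u) * (lam * \<theta> * \<beta> * ?u - lam)) (at x)"
    by (rule derivative_eq_intros refl)+ (simp add: algebra_simps)
  note de = DERIV_cdivide[OF DERIV_cmult[OF this], of "\<beta> * \<theta> * lam" "(1 - exp (- \<theta>)) powr \<beta>"]
  have score: "gpe_score \<theta> lam \<beta> x = (lam * \<theta> * \<beta> * ?u - lam) + (\<beta> - 1) * ?w' / ?w"
    unfolding gpe_score_def using arg_cong[OF *, of "\<lambda>z. (\<beta> - 1) * lam * \<theta> * z"] by (simp add: mult_ac)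
  show ?thesis
    unfolding score gpe_density_def[abs_def]
    by (rule DERIV_cong[OF DERIV_mult[OF de dw]])
      (simp only: distrib_left times_divide_eq_left times_divide_eq_right divide_divide_eq_left mult_ac)
qed

text \<open>Restricted to positive \<open>x\<close> because at 0 the base of the \<open>powr\<close>
  factor vanishes and \<open>0 powr 0\<close> is 0.\<close>

lemma pe_density_eq_gpe_density: "0 < \<theta> \<Longrightarrow> 0 < lam \<Longrightarrow> 0 < x \<Longrightarrow> pe_density \<theta> lam x = gpe_density \<theta> lam 1 x"
  by (simp add: pe_density_def gpe_density_def)

text \<open>Half of the exponential decay absorbs the linear growth of \<open>f\<close>, by
  \<open>y \<le> exp y\<close> at \<open>y = x * (lam / 2)\<close>; the other half remains as an
  integrable majorant. Writing \<open>B * x\<close> as \<open>2 * B / lam * y\<close> explains the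
  constant.\<close>

lemma set_integrable_gpe_density:
  assumes "0 < \<theta>" "0 < lam" "1 \<le> \<beta>" and f[measurable]: "f \<in> borel_measurable borel"
    and f_le: "\<And>x. 0 < x \<Longrightarrow> \<bar>f x\<bar> \<le> A + B * x"
  shows "set_integrable lborel {0<..} (\<lambda>x. gpe_density \<theta> lam \<beta> x * f x)"
proof -
  define C where "C = \<beta> * \<theta> * lam / (1 - exp (- \<theta>)) powr \<beta>"
  have C: "0 \<le> C" using assms by (simp add: C_def)
  have "set_integrable lborel {0<..} (\<lambda>x. C * (\<bar>A\<bar> + 2 * \<bar>B\<bar> / lam) * exp (- (x * (lam / 2))))"
    using integrable_I0i_exp_mscale[of "lam / 2"] assms by simp
  then show ?thesis
    unfolding set_integrable_def
  proof (rule Bochner_Integration.integrable_bound)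
    have "norm (gpe_density \<theta> lam \<beta> x * f x) \<le> C * (\<bar>A\<bar> + 2 * \<bar>B\<bar> / lam) * exp (- (x * (lam / 2)))"
      if x: "0 < x" for x
    proof -
      have y: "x * (lam / 2) \<le> exp (x * (lam / 2))" and 1: "1 \<le> exp (x * (lam / 2))"
        using exp_ge_add_one_self[of "x * (lam / 2)"] mult_nonneg_nonneg[of x "lam / 2"] x assms(2) by linarith+
      have "\<bar>f x\<bar> \<le> \<bar>A\<bar> * 1 + 2 * \<bar>B\<bar> / lam * (x * (lam / 2))"
        using order_trans[OF f_le[OF x] add_mono[OF abs_ge_self mult_right_mono[OF abs_ge_self, of x]]] x assms(2)
        by simp
      also have "\<dots> \<le> \<bar>A\<bar> * exp (x * (lam / 2)) + 2 * \<bar>B\<bar> / lam * exp (x * (lam / 2))"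
        using y 1 assms by (intro add_mono mult_left_mono) auto
      finally have f2: "\<bar>f x\<bar> \<le> (\<bar>A\<bar> + 2 * \<bar>B\<bar> / lam) * exp (x * (lam / 2))"
        by (simp add: algebra_simps)
      have "\<bar>gpe_density \<theta> lam \<beta> x * f x\<bar> \<le> (C * exp (- lam * x)) * ((\<bar>A\<bar> + 2 * \<bar>B\<bar> / lam) * exp (x * (lam / 2)))"
        unfolding abs_mult
        using f2 gpe_density_le[of \<theta> lam \<beta> x] gpe_density_nonneg[of \<theta> lam \<beta> x] assms x C
        by (intro mult_mono) (auto simp: C_def)
      also have "\<dots> = C * (\<bar>A\<bar> + 2 * \<bar>B\<bar> / lam) * (exp (- lam * x) * exp (x * (lam / 2)))"
        by (simp only: mult_ac)
      also have "exp (- lam * x) * exp (x * (lam / 2)) = exp (- (x * (lam / 2)))"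
        by (simp flip: exp_add)
      finally show ?thesis by simp
    qed
    then show "AE x in lborel. norm (indicat_real {0<..} x *\<^sub>R (gpe_density \<theta> lam \<beta> x * f x))
        \<le> norm (indicat_real {0<..} x *\<^sub>R (C * (\<bar>A\<bar> + 2 * \<bar>B\<bar> / lam) * exp (- (x * (lam / 2)))))"
      by (intro AE_I2) (auto simp: indicator_def intro: order_trans[OF _ abs_ge_self])
  qed simp
qed

section \<open>Comparison of the scores and the resulting bound on expectations\<close>

text \<open>The score difference splits into a constant, a difference of exponentials and the
  \<open>powr\<close> contribution \<open>E\<close>. Each is matched with the bound on
  \<open>R\<close> that compensates it: \<open>2 * S\<close> for the constant, \<open>S\<close> for
  the exponentials, and the one vanishing at 0 for \<open>E\<close>, whose denominator vanishes
  there.\<close>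

lemma score_diff_mult_le:
  fixes R S :: real
  assumes pos: "0 < \<theta>\<^sub>1" "0 < \<theta>\<^sub>2" "0 < lam\<^sub>1" "0 < x" and le: "lam\<^sub>1 \<le> lam\<^sub>2" and \<beta>: "1 \<le> \<beta>"
    and R: "0 \<le> R" "lam\<^sub>1 * R \<le> 2 * S"
      "lam\<^sub>1 * \<theta>\<^sub>1 * exp (- lam\<^sub>1 * x) * R \<le> S * (1 - exp (- \<theta>\<^sub>1 * (1 - exp (- lam\<^sub>1 * x))))"
  shows "\<bar>gpe_score \<theta>\<^sub>2 lam\<^sub>2 \<beta> x - gpe_score \<theta>\<^sub>1 lam\<^sub>1 1 x\<bar> * R
    \<le> S * (lam\<^sub>2 / lam\<^sub>1 * \<bar>\<beta> - 1\<bar> + \<bar>lam\<^sub>2 * \<theta>\<^sub>2 / (lam\<^sub>1 * \<theta>\<^sub>1) * \<beta> - 1\<bar>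
        + (lam\<^sub>2 / lam\<^sub>1 - 1) * (lam\<^sub>1 * x + 2))"
proof -
  \<comment> \<open>Factoring \<open>u = s * v\<close> gives both exponential terms the common
    factor \<open>v\<close>, in which the bounds on \<open>R\<close> are expressed.\<close>
  define u v s where "u = exp (- lam\<^sub>2 * x)" and "v = exp (- lam\<^sub>1 * x)" and "s = exp (- (lam\<^sub>2 - lam\<^sub>1) * x)"
  define r where "r = lam\<^sub>2 * \<theta>\<^sub>2 / (lam\<^sub>1 * \<theta>\<^sub>1) * \<beta>"
  define E where "E = (\<beta> - 1) * lam\<^sub>2 * \<theta>\<^sub>2 * u / (exp (\<theta>\<^sub>2 * (1 - u)) - 1)"
  have lam\<^sub>2: "0 < lam\<^sub>2" using pos le by simp
  have u: "0 < u" "u < 1" and v: "0 < v" "v < 1" and "u \<le> v"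
    using pos le lam\<^sub>2 by (auto simp: u_def v_def)
  have s: "0 < s" "s \<le> 1" "1 - s \<le> (lam\<^sub>2 - lam\<^sub>1) * x" and usv: "u = s * v"
    using pos le exp_ge_add_one_self[of "- (lam\<^sub>2 - lam\<^sub>1) * x"]
    by (auto simp: s_def u_def v_def algebra_simps simp flip: exp_add)
  have "0 \<le> lam\<^sub>1 * R" using pos R by simp
  then have S: "0 \<le> S" using R by simp
  have bound_v: "lam\<^sub>1 * \<theta>\<^sub>1 * v * R \<le> S"
    using R(3) mult_left_mono[OF _ S, of "1 - exp (- \<theta>\<^sub>1 * (1 - v))" 1] by (simp add: v_def)
  have "S * (1 - exp (- \<theta>\<^sub>1 * (1 - v))) \<le> S * (\<theta>\<^sub>1 * (1 - v))"
    using exp_ge_add_one_self[of "- \<theta>\<^sub>1 * (1 - v)"] by (intro mult_left_mono S) auto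
  then have "\<theta>\<^sub>1 * (lam\<^sub>1 * v * R) \<le> \<theta>\<^sub>1 * (S * (1 - v))"
    using R(3) by (simp add: v_def mult_ac)
  then have bound_1v: "lam\<^sub>1 * v * R \<le> S * (1 - v)" using pos by simp
  have term1: "\<bar>lam\<^sub>1 - lam\<^sub>2\<bar> * R \<le> S * ((lam\<^sub>2 / lam\<^sub>1 - 1) * 2)"
  proof -
    have "\<bar>lam\<^sub>1 - lam\<^sub>2\<bar> * R = (lam\<^sub>2 / lam\<^sub>1 - 1) * (lam\<^sub>1 * R)"
      using pos le by (simp add: field_simps)
    also have "\<dots> \<le> (lam\<^sub>2 / lam\<^sub>1 - 1) * (2 * S)"
      using R pos le by (intro mult_left_mono) auto
    finally show ?thesis by (simp add: mult_ac)
  qed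
  have term2: "\<bar>lam\<^sub>2 * \<theta>\<^sub>2 * \<beta> * u - lam\<^sub>1 * \<theta>\<^sub>1 * v\<bar> * R \<le> S * (\<bar>r - 1\<bar> + (lam\<^sub>2 / lam\<^sub>1 - 1) * (lam\<^sub>1 * x))"
  proof -
    \<comment> \<open>Separates the parameter mismatch \<open>r - 1\<close> from the rate mismatch
      \<open>1 - s\<close>. The latter is at most linear in \<open>x\<close>, and this is where the
      expectation of \<open>X\<close> enters the result.\<close>
    have "r * s - 1 = (r - 1) * s - (1 - s)" by (simp add: algebra_simps)
    then have "\<bar>r * s - 1\<bar> \<le> \<bar>r - 1\<bar> * s + (1 - s)"
      using abs_triangle_ineq4[of "(r - 1) * s" "1 - s"] s by (simp add: abs_mult)
    also have "\<dots> \<le> \<bar>r - 1\<bar> + (lam\<^sub>2 - lam\<^sub>1) * x"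
      using s by (intro add_mono mult_left_le) auto
    also have "(lam\<^sub>2 - lam\<^sub>1) * x = (lam\<^sub>2 / lam\<^sub>1 - 1) * (lam\<^sub>1 * x)"
      using pos by (simp add: field_simps)
    finally have rs: "\<bar>r * s - 1\<bar> \<le> \<bar>r - 1\<bar> + (lam\<^sub>2 / lam\<^sub>1 - 1) * (lam\<^sub>1 * x)" .
    have "lam\<^sub>2 * \<theta>\<^sub>2 * \<beta> * u - lam\<^sub>1 * \<theta>\<^sub>1 * v = (r * s - 1) * (lam\<^sub>1 * \<theta>\<^sub>1 * v)"
      using pos by (simp add: r_def usv field_simps)
    then have "\<bar>lam\<^sub>2 * \<theta>\<^sub>2 * \<beta> * u - lam\<^sub>1 * \<theta>\<^sub>1 * v\<bar> * R = \<bar>r * s - 1\<bar> * (lam\<^sub>1 * \<theta>\<^sub>1 * v * R)"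
      using pos v by (simp add: abs_mult)
    also have "\<dots> \<le> \<bar>r * s - 1\<bar> * S" using bound_v by (intro mult_left_mono) auto
    also have "\<dots> \<le> S * (\<bar>r - 1\<bar> + (lam\<^sub>2 / lam\<^sub>1 - 1) * (lam\<^sub>1 * x))"
      using mult_left_mono[OF rs S] by (simp only: mult.commute)
    finally show ?thesis .
  qed
  have term3: "\<bar>E\<bar> * R \<le> S * (lam\<^sub>2 / lam\<^sub>1 * \<bar>\<beta> - 1\<bar>)"
  proof -
    have "\<theta>\<^sub>2 * (1 - u) \<le> exp (\<theta>\<^sub>2 * (1 - u)) - 1" (is "_ \<le> ?e")
      using exp_ge_add_one_self[of "\<theta>\<^sub>2 * (1 - u)"] by linarith
    moreover have e: "0 < ?e" using pos u by simp
    ultimately have ratio: "\<theta>\<^sub>2 * (1 - u) / ?e \<le> 1" by simp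
    have "lam\<^sub>1 * (u * R) \<le> lam\<^sub>1 * (v * R)"
      using \<open>u \<le> v\<close> pos R by (intro mult_left_mono mult_right_mono) auto
    also have "\<dots> \<le> S * (1 - v)" using bound_1v by (simp add: mult_ac)
    \<comment> \<open>Passing from \<open>v\<close> to \<open>u\<close> produces exactly the factor
      \<open>1 - u\<close> that the denominator \<open>?e \<ge> \<theta>\<^sub>2 * (1 - u)\<close>
      cancels.\<close>
    also have "\<dots> \<le> S * (1 - u)" using \<open>u \<le> v\<close> S by (intro mult_left_mono) auto
    finally have uR: "lam\<^sub>1 * (u * R) \<le> S * (1 - u)" .
    have "\<bar>E\<bar> * R = (lam\<^sub>2 / lam\<^sub>1 * (\<beta> - 1)) * (\<theta>\<^sub>2 / ?e * (lam\<^sub>1 * (u * R)))"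
      using pos lam\<^sub>2 \<beta> u e by (simp add: E_def abs_mult)
    also have "\<dots> \<le> (lam\<^sub>2 / lam\<^sub>1 * (\<beta> - 1)) * (\<theta>\<^sub>2 / ?e * (S * (1 - u)))"
      using pos lam\<^sub>2 \<beta> e uR by (intro mult_left_mono) auto
    also have "\<dots> = (lam\<^sub>2 / lam\<^sub>1 * (\<beta> - 1)) * (S * (\<theta>\<^sub>2 * (1 - u) / ?e))"
      by simp
    also have "\<dots> \<le> (lam\<^sub>2 / lam\<^sub>1 * (\<beta> - 1)) * (S * 1)"
      using pos lam\<^sub>2 \<beta> S ratio by (intro mult_left_mono) auto
    finally show ?thesis using \<beta> by (simp add: mult_ac)
  qed
  have "gpe_score \<theta>\<^sub>2 lam\<^sub>2 \<beta> x - gpe_score \<theta>\<^sub>1 lam\<^sub>1 1 x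
    = (lam\<^sub>1 - lam\<^sub>2) + (lam\<^sub>2 * \<theta>\<^sub>2 * \<beta> * u - lam\<^sub>1 * \<theta>\<^sub>1 * v) + E"
    by (simp add: gpe_score_def E_def u_def v_def)
  then have "\<bar>gpe_score \<theta>\<^sub>2 lam\<^sub>2 \<beta> x - gpe_score \<theta>\<^sub>1 lam\<^sub>1 1 x\<bar> * R
    \<le> (\<bar>lam\<^sub>1 - lam\<^sub>2\<bar> + \<bar>lam\<^sub>2 * \<theta>\<^sub>2 * \<beta> * u - lam\<^sub>1 * \<theta>\<^sub>1 * v\<bar> + \<bar>E\<bar>) * R"
    using R by (intro mult_right_mono) linarith+
  also have "\<dots> \<le> S * (lam\<^sub>2 / lam\<^sub>1 * \<bar>\<beta> - 1\<bar> + \<bar>r - 1\<bar> + (lam\<^sub>2 / lam\<^sub>1 - 1) * (lam\<^sub>1 * x + 2))"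
    using term1 term2 term3 by (simp add: distrib_left distrib_right)
  finally show ?thesis unfolding r_def .
qed

text \<open>Integration by parts with \<open>g\<close> the centred integrand under the first density
  and \<open>q\<close> the density ratio. As \<open>q' = q * D\<close>, the new integrand has
  modulus \<open>?p2 x * (\<bar>D x\<bar> * R x)\<close>, to which the pointwise comparison
  applies.\<close>

lemma gpe_expectation_le:
  fixes k :: "real \<Rightarrow> real"
  assumes pos: "0 < \<theta>\<^sub>1" "0 < \<theta>\<^sub>2" "0 < lam\<^sub>1" and le: "lam\<^sub>1 \<le> lam\<^sub>2" and \<beta>: "1 \<le> \<beta>"
    and k[measurable]: "k \<in> borel_measurable borel" and k_le: "\<And>x. 0 < x \<Longrightarrow> \<bar>k x\<bar> \<le> S"
    and centred: "(LINT x:{0<..}|lborel. pe_density \<theta>\<^sub>1 lam\<^sub>1 x * k x) = 0"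
  shows "\<bar>LINT x:{0<..}|lborel. gpe_density \<theta>\<^sub>2 lam\<^sub>2 \<beta> x * k x\<bar>
    \<le> (LINT x:{0<..}|lborel. gpe_density \<theta>\<^sub>2 lam\<^sub>2 \<beta> x *
        (S * (lam\<^sub>2 / lam\<^sub>1 * \<bar>\<beta> - 1\<bar> + \<bar>lam\<^sub>2 * \<theta>\<^sub>2 / (lam\<^sub>1 * \<theta>\<^sub>1) * \<beta> - 1\<bar>
        + (lam\<^sub>2 / lam\<^sub>1 - 1) * (lam\<^sub>1 * x + 2))))"
proof -
  let ?p1 = "pe_density \<theta>\<^sub>1 lam\<^sub>1" and ?p2 = "gpe_density \<theta>\<^sub>2 lam\<^sub>2 \<beta>"
  define D where "D = (\<lambda>x. gpe_score \<theta>\<^sub>2 lam\<^sub>2 \<beta> x - gpe_score \<theta>\<^sub>1 lam\<^sub>1 1 x)"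
  define g where "g = (\<lambda>x. indicator {0<..} x *\<^sub>R (?p1 x * k x))"
  define q where "q = (\<lambda>x. ?p2 x / ?p1 x)"
  define G where "G = (\<lambda>t. LINT x:{..t}|lborel. g x)"
  define R where "R = (\<lambda>x. \<bar>G x\<bar> / ?p1 x)"
  define \<kappa> where "\<kappa> = (\<lambda>x. S * (lam\<^sub>2 / lam\<^sub>1 * \<bar>\<beta> - 1\<bar> + \<bar>lam\<^sub>2 * \<theta>\<^sub>2 / (lam\<^sub>1 * \<theta>\<^sub>1) * \<beta> - 1\<bar>
        + (lam\<^sub>2 / lam\<^sub>1 - 1) * (lam\<^sub>1 * x + 2)))"
  have lam\<^sub>2: "0 < lam\<^sub>2" using pos le by simp
  have S: "0 \<le> S" using k_le[of 1] by simp
  have p1: "0 < ?p1 x" and p2: "0 \<le> ?p2 x" for x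
    using pos lam\<^sub>2 \<beta> by (auto intro: pe_density_pos gpe_density_nonneg)
  have int2: "set_integrable lborel {0<..} (\<lambda>x. ?p2 x * k x)"
    using set_integrable_gpe_density[of \<theta>\<^sub>2 lam\<^sub>2 \<beta> k S 0] pos lam\<^sub>2 \<beta> k_le by simp
  have "set_integrable lborel {0<..} (\<lambda>x. gpe_density \<theta>\<^sub>1 lam\<^sub>1 1 x * k x)"
    using set_integrable_gpe_density[of \<theta>\<^sub>1 lam\<^sub>1 1 k S 0] pos k_le by simp
  then have g: "integrable lborel g"
    unfolding g_def set_integrable_def
    by (rule Bochner_Integration.integrable_cong[THEN iffD1, rotated -1])
      (use pos in \<open>auto simp: indicator_def pe_density_eq_gpe_density\<close>)
  have g0: "(\<integral>t. g t \<partial>lborel) = 0"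
    using centred unfolding g_def set_lebesgue_integral_def .
  have g_le: "\<bar>g t\<bar> \<le> S * (indicator {0<..} t * ?p1 t)" for t
    using k_le[of t] p1[of t] by (auto simp: g_def indicator_def abs_mult mult.commute)
  have R0: "0 \<le> R x" for x using p1[of x] by (simp add: R_def)
  have R1: "lam\<^sub>1 * \<theta>\<^sub>1 * exp (- lam\<^sub>1 * x) * R x \<le> S * (1 - exp (- \<theta>\<^sub>1 * (1 - exp (- lam\<^sub>1 * x))))"
    and R2: "lam\<^sub>1 * R x \<le> 2 * S" if "0 < x" for x
    using stein_pe_le_cdf[OF pos(1,3) _ g g0 g_le] stein_pe_le[OF pos(1,3) _ g g0 g_le] that
    unfolding R_def G_def by auto
  have qG: "\<bar>q x * G x\<bar> = ?p2 x * R x" for x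
    using p1[of x] p2[of x] by (simp add: q_def R_def abs_mult)
  have dq: "(q has_real_derivative q x * D x) (at x)" if x: "0 < x" for x
  proof -
    \<comment> \<open>The two densities agree on the open half-line, so the derivative carries over
      from the case \<beta> = 1; the quotient rule then yields the difference of scores.\<close>
    have "(?p1 has_real_derivative ?p1 x * gpe_score \<theta>\<^sub>1 lam\<^sub>1 1 x) (at x)"
      unfolding pe_density_eq_gpe_density[OF pos(1,3) x]
      by (rule has_field_derivative_transform_within_open[OF DERIV_gpe_density[OF pos(1,3) x] open_greaterThan[of 0]])
        (use x pos in \<open>auto simp: pe_density_eq_gpe_density\<close>)
    then show ?thesis
      unfolding q_def D_def
      by (rule DERIV_cong[OF DERIV_divide[OF DERIV_gpe_density[OF pos(2) lam\<^sub>2 x]]])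
        (use p1[of x] in \<open>auto simp: field_simps\<close>)
  qed
  have cD: "continuous_on {0<..} (\<lambda>x. q x * D x)"
  proof -
    have "exp (\<theta>\<^sub>1 * (1 - exp (- lam\<^sub>1 * x))) - 1 \<noteq> 0" "exp (\<theta>\<^sub>2 * (1 - exp (- lam\<^sub>2 * x))) - 1 \<noteq> 0"
      if "x \<in> {0<..}" for x
      using that pos lam\<^sub>2 by auto
    then have "continuous_on {0<..} D"
      unfolding D_def gpe_score_def by (intro continuous_intros) auto
    moreover have "continuous_on {0<..} q"
      using dq by (meson DERIV_isCont continuous_at_imp_continuous_on greaterThan_iff)
    ultimately show ?thesis by (intro continuous_intros)
  qed
  have \<kappa>_int: "set_integrable lborel {0<..} (\<lambda>x. ?p2 x * \<kappa> x)"
  proof (rule set_integrable_gpe_density[OF pos(2) lam\<^sub>2 \<beta>])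
    \<comment> \<open>\<open>\<kappa>\<close> is affine and nonnegative on the positive axis, so it
      meets the linear growth condition.\<close>
    show "\<bar>\<kappa> x\<bar> \<le> \<kappa> 0 + S * (lam\<^sub>2 - lam\<^sub>1) * x" if "0 < x" for x
    proof -
      have "\<kappa> x = \<kappa> 0 + S * (lam\<^sub>2 - lam\<^sub>1) * x"
        using pos by (simp add: \<kappa>_def field_simps)
      moreover have "0 \<le> \<kappa> x"
        unfolding \<kappa>_def using S pos lam\<^sub>2 le that by (intro mult_nonneg_nonneg add_nonneg_nonneg) auto
      ultimately show ?thesis by simp
    qed
  qed (simp add: \<kappa>_def)
  define C where "C = \<beta> * \<theta>\<^sub>2 * lam\<^sub>2 / (1 - exp (- \<theta>\<^sub>2)) powr \<beta>"
  have p2_le: "?p2 x \<le> C * exp (- lam\<^sub>2 * x)" if "0 < x" for x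
    unfolding C_def using that pos lam\<^sub>2 \<beta> by (intro gpe_density_le)
  have C: "0 \<le> C" using pos lam\<^sub>2 \<beta> by (simp add: C_def)
  \<comment> \<open>At infinity the uniform bound on \<open>R\<close> suffices, since the envelope
    of \<open>?p2\<close> decays.\<close>
  have lim_top: "((\<lambda>x. q x * G x) \<longlongrightarrow> 0) at_top"
  proof (rule Lim_null_comparison)
    show "\<forall>\<^sub>F x in at_top. norm (q x * G x) \<le> C * exp (- lam\<^sub>2 * x) * (2 * S / lam\<^sub>1)"
      using eventually_gt_at_top[of 0]
    proof eventually_elim
      case (elim x)
      then show ?case unfolding real_norm_def qG
        using R0[of x] R2[of x] p2[of x] p2_le[of x] C pos
        by (intro mult_mono) (auto simp: field_simps)
    qed
    show "((\<lambda>x. C * exp (- lam\<^sub>2 * x) * (2 * S / lam\<^sub>1)) \<longlongrightarrow> 0) at_top"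
    proof -
      have "((\<lambda>x. exp (- lam\<^sub>2 * x)) \<longlongrightarrow> 0) at_top" using lam\<^sub>2 by real_asymp
      from tendsto_mult_left_zero[OF tendsto_mult_right_zero[OF this]] show ?thesis .
    qed
  qed
  \<comment> \<open>Near 0 the envelope of \<open>?p2\<close> is only bounded, so the decay must
    come from \<open>R\<close>: its lower-tail bound is continuous and vanishes at 0.\<close>
  have lim_0: "((\<lambda>x. q x * G x) \<longlongrightarrow> 0) (at_right 0)"
  proof (rule Lim_null_comparison)
    let ?b = "\<lambda>x. C * (S * (1 - exp (- \<theta>\<^sub>1 * (1 - exp (- lam\<^sub>1 * x)))) / (lam\<^sub>1 * \<theta>\<^sub>1 * exp (- lam\<^sub>1 * x)))"
    show "\<forall>\<^sub>F x in at_right 0. norm (q x * G x) \<le> ?b x"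
      using eventually_at_right_less[of 0]
    proof eventually_elim
      case (elim x)
      have "R x \<le> S * (1 - exp (- \<theta>\<^sub>1 * (1 - exp (- lam\<^sub>1 * x)))) / (lam\<^sub>1 * \<theta>\<^sub>1 * exp (- lam\<^sub>1 * x))"
        using R1[OF elim] pos by (simp add: pos_le_divide_eq mult_ac)
      moreover have "?p2 x \<le> C"
        using p2_le[OF elim] mult_left_mono[OF _ C, of "exp (- lam\<^sub>2 * x)" 1] elim lam\<^sub>2 by simp
      ultimately show ?case unfolding real_norm_def qG
        using R0[of x] p2[of x] C by (intro mult_mono) auto
    qed
    have "isCont ?b 0" using pos by (intro continuous_intros) auto
    then have "(?b \<longlongrightarrow> ?b 0) (at_right 0)"
      by (meson continuous_within filterlim_at_split isCont_def)
    then show "(?b \<longlongrightarrow> 0) (at_right 0)" by simp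
  qed
  have cancel: "indicator {0<..} x *\<^sub>R (g x * q x) = indicator {0<..} x *\<^sub>R (?p2 x * k x)" for x
    using p1[of x] by (simp add: g_def q_def indicator_def)
  have "\<bar>LINT x:{0<..}|lborel. g x * q x\<bar> \<le> (LINT x:{0<..}|lborel. ?p2 x * \<kappa> x)"
  proof (rule integral_mult_le_by_parts[OF g dq cD _ \<kappa>_int])
    show "set_integrable lborel {0<..} (\<lambda>x. g x * q x)"
      using int2 unfolding set_integrable_def cancel .
    show "\<bar>q x * D x * (LINT x:{..x}|lborel. g x)\<bar> \<le> ?p2 x * \<kappa> x" if x: "0 < x" for x
    proof -
      have "\<bar>q x * D x * G x\<bar> = ?p2 x * (\<bar>D x\<bar> * R x)"
        using qG[of x] by (simp add: abs_mult mult_ac)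
      also have "\<dots> \<le> ?p2 x * \<kappa> x"
        unfolding D_def \<kappa>_def
        by (intro mult_left_mono[OF _ p2] score_diff_mult_le pos x le \<beta> R0 R1 R2)
      finally show ?thesis unfolding G_def .
    qed
  qed (use lim_0 lim_top in \<open>auto simp: G_def\<close>)
  then show ?thesis unfolding set_lebesgue_integral_def cancel \<kappa>_def .
qed

section \<open>Transfer to random variables and conclusion\<close>

lemma borel_measurable_pos_lborel:
  "borel_measurable pos_lborel = borel_measurable (restrict_space borel {0<..})"
  unfolding pos_lborel_def by (intro measurable_cong_sets sets_restrict_space_cong) auto

lemma
  fixes f p :: "real \<Rightarrow> real"
  assumes "distributed P pos_lborel Y (\<lambda>x. ennreal (p x))" "f \<in> borel_measurable pos_lborel"
    and "\<And>x. 0 \<le> p x"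
  shows integral_distributed_pos_lborel:
      "(\<integral>\<omega>. f (Y \<omega>) \<partial>P) = (LINT x:{0<..}|lborel. p x * f x)"
    and integrable_distributed_pos_lborel:
      "integrable P (\<lambda>\<omega>. f (Y \<omega>)) \<longleftrightarrow> set_integrable lborel {0<..} (\<lambda>x. p x * f x)"
  using distributed_integral[OF assms(1,2)] distributed_integrable[OF assms(1,2)] assms(3)
  by (auto simp: pos_lborel_def integral_restrict_space integrable_restrict_space
      set_lebesgue_integral_def set_integrable_def)

lemma distributed_pos_lborel_pos:
  "distributed P pos_lborel Y p \<Longrightarrow> \<omega> \<in> space P \<Longrightarrow> 0 < Y \<omega>"
  using measurable_space[OF distributed_measurable, of P pos_lborel Y p \<omega>]
  by (simp add: pos_lborel_def space_restrict_space)

theorem theorem4p6: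
  fixes \<theta>\<^sub>1 \<theta>\<^sub>2 lam\<^sub>1 lam\<^sub>2 \<beta> :: real
    and M :: "'a measure" and N :: "'b measure"
    and W :: "'a \<Rightarrow> real" and X :: "'b \<Rightarrow> real"
    and h :: "real \<Rightarrow> real"
  assumes "\<theta>\<^sub>1 > 0" and "\<theta>\<^sub>2 > 0" and "lam\<^sub>1 > 0" and "lam\<^sub>2 > 0"
    and "\<beta> \<ge> 1" and "lam\<^sub>1 \<le> lam\<^sub>2"
    and "prob_space M" and "prob_space N"
    and "distributed M pos_lborel W (\<lambda>w. ennreal (pe_density \<theta>\<^sub>1 lam\<^sub>1 w))"
    and "distributed N pos_lborel X (\<lambda>x. ennreal (gpe_density \<theta>\<^sub>2 lam\<^sub>2 \<beta> x))"
    and "h \<in> borel_measurable (restrict_space borel {0<..})"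
    and "bounded (h ` {0<..})"
  shows "\<bar>prob_space.expectation N (\<lambda>\<omega>. h (X \<omega>)) - prob_space.expectation M (\<lambda>\<omega>. h (W \<omega>))\<bar>
    \<le> pos_sup_norm (\<lambda>x. h x - prob_space.expectation M (\<lambda>\<omega>. h (W \<omega>)))
       * (lam\<^sub>2 / lam\<^sub>1 * \<bar>\<beta> - 1\<bar>
          + \<bar>lam\<^sub>2 * \<theta>\<^sub>2 / (lam\<^sub>1 * \<theta>\<^sub>1) * \<beta> - 1\<bar>
          + (lam\<^sub>2 / lam\<^sub>1 - 1) * (lam\<^sub>1 * prob_space.expectation N X + 2))"
proof -
  interpret M: prob_space M by fact
  interpret N: prob_space N by fact
  note pos = assms(1-4) and \<beta> = assms(5) and W = assms(9) and X = assms(10)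
  let ?p1 = "pe_density \<theta>\<^sub>1 lam\<^sub>1" and ?p2 = "gpe_density \<theta>\<^sub>2 lam\<^sub>2 \<beta>"
  define m where "m = M.expectation (\<lambda>\<omega>. h (W \<omega>))"
  define S where "S = pos_sup_norm (\<lambda>x. h x - m)"
  define k where "k = (\<lambda>x. indicator {0<..} x *\<^sub>R (h x - m))"
  define A where "A = lam\<^sub>2 / lam\<^sub>1 * \<bar>\<beta> - 1\<bar> + \<bar>lam\<^sub>2 * \<theta>\<^sub>2 / (lam\<^sub>1 * \<theta>\<^sub>1) * \<beta> - 1\<bar>"
  have p: "0 \<le> ?p1 x" "0 \<le> ?p2 x" for x
    using pos \<beta> by (auto intro: less_imp_le[OF pe_density_pos] gpe_density_nonneg)
  have k[measurable]: "k \<in> borel_measurable borel"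
    using borel_measurable_restrict_space_iff[of "{0<..}" borel "\<lambda>x. h x - m"] assms(11)
    by (simp add: k_def)
  have restrict: "f \<in> borel_measurable pos_lborel" if "f \<in> borel_measurable borel" for f :: "real \<Rightarrow> real"
    unfolding borel_measurable_pos_lborel using that by (rule measurable_restrict_space1)
  obtain B where B: "\<bar>h x\<bar> \<le> B" if "0 < x" for x
    using assms(12) unfolding bounded_iff by (metis greaterThan_iff imageI real_norm_def)
  have "\<bar>h x - m\<bar> \<le> B + \<bar>m\<bar>" if "x \<in> {0<..}" for x
    using B[of x] that by auto
  \<comment> \<open>Boundedness of \<open>h\<close> gives the supremum its meaning; only then does
    it dominate every value of \<open>k\<close>.\<close>
  then have "bdd_above ((\<lambda>x. \<bar>h x - m\<bar>) ` {0<..})" by (rule bdd_aboveI2)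
  then have k_le: "\<bar>k x\<bar> \<le> S" if "0 < x" for x
    unfolding S_def pos_sup_norm_def using cSUP_upper[of x "{0<..}" "\<lambda>x. \<bar>h x - m\<bar>"] that
    by (simp add: k_def)
  have "set_integrable lborel {0<..} (\<lambda>x. ?p2 x * k x)"
    using pos \<beta> k_le by (intro set_integrable_gpe_density[where A = S and B = 0]) auto
  \<comment> \<open>This makes \<open>X\<close> integrable, so that the affine bound can later be
    integrated termwise.\<close>
  moreover have "set_integrable lborel {0<..} (\<lambda>x. ?p2 x * x)"
    using pos \<beta> by (intro set_integrable_gpe_density[where A = 0 and B = 1]) auto
  ultimately have int_N: "integrable N (\<lambda>\<omega>. k (X \<omega>))" "integrable N X"
    using integrable_distributed_pos_lborel[OF X restrict p(2), of k]
      integrable_distributed_pos_lborel[OF X restrict p(2), of "\<lambda>x. x"] by simp_all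
  have W_meas: "(\<lambda>\<omega>. k (W \<omega>)) \<in> borel_measurable M"
    using measurable_compose[OF distributed_measurable[OF W] restrict[OF k]] .
  have int_M: "integrable M (\<lambda>\<omega>. k (W \<omega>))"
    by (rule M.integrable_const_bound[where B = S, OF _ W_meas])
      (use k_le distributed_pos_lborel_pos[OF W] in auto)
  \<comment> \<open>\<open>W\<close> takes only positive values, so the cut-off in \<open>k\<close>
    is invisible and \<open>k (W \<omega>)\<close> has mean 0.\<close>
  have "M.expectation (\<lambda>\<omega>. h (W \<omega>)) = M.expectation (\<lambda>\<omega>. k (W \<omega>) + m)"
    using distributed_pos_lborel_pos[OF W] by (intro Bochner_Integration.integral_cong) (auto simp: k_def)
  then have "M.expectation (\<lambda>\<omega>. k (W \<omega>)) = 0"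
    using int_M by (simp add: M.prob_space flip: m_def)
  then have centred: "(LINT x:{0<..}|lborel. ?p1 x * k x) = 0"
    using integral_distributed_pos_lborel[OF W restrict[OF k] p(1)] by simp
  have "N.expectation (\<lambda>\<omega>. h (X \<omega>)) = N.expectation (\<lambda>\<omega>. k (X \<omega>) + m)"
    using distributed_pos_lborel_pos[OF X] by (intro Bochner_Integration.integral_cong) (auto simp: k_def)
  also have "\<dots> = N.expectation (\<lambda>\<omega>. k (X \<omega>)) + m"
    using int_N by (simp add: N.prob_space)
  finally have "\<bar>N.expectation (\<lambda>\<omega>. h (X \<omega>)) - m\<bar> = \<bar>N.expectation (\<lambda>\<omega>. k (X \<omega>))\<bar>" by simp
  also have "\<dots> = \<bar>LINT x:{0<..}|lborel. ?p2 x * k x\<bar>"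
    by (simp add: integral_distributed_pos_lborel[OF X restrict[OF k] p(2)])
  also have "\<dots> \<le> (LINT x:{0<..}|lborel. ?p2 x * (S * (A + (lam\<^sub>2 / lam\<^sub>1 - 1) * (lam\<^sub>1 * x + 2))))"
    unfolding A_def using pos \<beta> assms(6) by (intro gpe_expectation_le k k_le centred)
  also have "\<dots> = N.expectation (\<lambda>\<omega>. S * (A + (lam\<^sub>2 / lam\<^sub>1 - 1) * (lam\<^sub>1 * X \<omega> + 2)))"
    by (rule integral_distributed_pos_lborel[OF X restrict p(2), symmetric]) simp
  also have "\<dots> = S * (A + (lam\<^sub>2 / lam\<^sub>1 - 1) * (lam\<^sub>1 * N.expectation X + 2))"
    using int_N by (simp add: N.prob_space)
  finally show ?thesis unfolding S_def A_def m_def .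
qed

end
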